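(* Assume $\alpha>1$, $R(0)>\sqrt{\delta/(\alpha-1)}$ and $$k<\frac{8\delta}{\Big(\alpha-1-\dfrac{\delta}{R(T)^2}\Big)^2}.$$ Then, for the given initial grid data $\boldsymbol V^0=\boldsymbol v^0\in\mathbb{R}^J_{\mathrm{per}}$, there exist $\boldsymbol V^1,\dots,\boldsymbol V^N\in\mathbb{R}^J_{\mathrm{per}}$ satisfying the Crank--Nicolson scheme $$\frac1k(\boldsymbol V^{n+1}-\boldsymbol V^n)+\mathcal L_h^{n+\frac12}\boldsymbol V^{n+\frac12}=\frac{v_c}{6hR_{n+\frac12}^2}\boldsymbol\varphi(\boldsymbol V^{n+\frac12},\boldsymbol V^{n+\frac12}),\qquad n=0,\dots,N-1,$$ where $\boldsymbol V^{n+\frac12}=\frac12(\boldsymbol V^n+\boldsymbol V^{n+1})$.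
   Context: Constants and radius: $\delta>0$, $\alpha>0$, $v_c\in\mathbb{R}$, $T>0$ are fixed. $R:[0,T]\to(0,\infty)$ is a given solution of $\dot R=v_c+(\alpha-1)/R$, $R(0)=R_0>0$, which is expanding ($\dot R>0$). Grid: $J,N\in\mathbb{N}$, $h=2\pi/J$, $k=T/N$; $R_m=R(mk)$ for integer or half-integer $m$. $\mathbb{R}^J_{\mathrm{per}}=\{\boldsymbol V=(V_i)_{i\in\mathbb{Z}}: V_i\in\mathbb{R},\ V_{i+J}=V_i\}$. For $\boldsymbol V,\boldsymbol W\in\mathbb{R}^J_{\mathrm{per}}$: $\Delta_hV_i=h^{-2}(V_{i-1}-2V_i+V_{i+1})$, $\Delta_h^2V_i=h^{-2}(\Delta_hV_{i-1}-2\Delta_hV_i+\Delta_hV_{i+1})$, $$(\mathcal L_h^m\boldsymbol V)_i=\frac{\delta}{R_m^4}\Delta_h^2V_i+\frac1{R_m^2}\Big(\alpha-1+\frac{\delta}{R_m^2}\Big)\Delta_hV_i+\frac{\alpha-1}{R_m^2}V_i,$$ $$(\boldsymbol\varphi(\boldsymbol V,\boldsymbol W))_i=(V_{i-1}+V_i+V_{i+1})(W_{i+1}-W_{i-1}).$$ The initial data $\boldsymbol v^0=(v_i^0)$ are the grid values $v(ih,0)$ of a $2\pi$-periodic function; standing assumption: $h\sum_{i=1}^Jv_i^0=0$. *)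

theory Defs
  imports "HOL-Analysis.Analysis"
begin

type_synonym grid_fun = "int \<Rightarrow> real"

definition periodic_grid :: "nat \<Rightarrow> grid_fun set" where
  "periodic_grid J = {V. \<forall>i. V (i + int J) = V i}"

definition laplace_h :: "real \<Rightarrow> grid_fun \<Rightarrow> grid_fun" where
  "laplace_h h V = (\<lambda>i. (V (i - 1) - 2 * V i + V (i + 1)) / h\<^sup>2)"

definition bilaplace_h :: "real \<Rightarrow> grid_fun \<Rightarrow> grid_fun" where
  "bilaplace_h h V =
     (\<lambda>i. (laplace_h h V (i - 1) - 2 * laplace_h h V i + laplace_h h V (i + 1)) / h\<^sup>2)"

text \<open>The time level enters only through the radius at that level, passed as \<open>r\<close>.\<close>

definition lin_op :: "real \<Rightarrow> real \<Rightarrow> real \<Rightarrow> real \<Rightarrow> grid_fun \<Rightarrow> grid_fun" where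
  "lin_op \<delta> \<alpha> h r V =
     (\<lambda>i. \<delta> / r ^ 4 * bilaplace_h h V i
          + 1 / r\<^sup>2 * (\<alpha> - 1 + \<delta> / r\<^sup>2) * laplace_h h V i
          + (\<alpha> - 1) / r\<^sup>2 * V i)"

definition phi :: "grid_fun \<Rightarrow> grid_fun \<Rightarrow> grid_fun" where
  "phi V W = (\<lambda>i. (V (i - 1) + V i + V (i + 1)) * (W (i + 1) - W (i - 1)))"

definition midpoint_level :: "(nat \<Rightarrow> grid_fun) \<Rightarrow> nat \<Rightarrow> grid_fun" where
  "midpoint_level V n = (\<lambda>i. (V n i + V (Suc n) i) / 2)"

definition crank_nicolson_step ::
  "real \<Rightarrow> real \<Rightarrow> real \<Rightarrow> (real \<Rightarrow> real) \<Rightarrow> real \<Rightarrow> real \<Rightarrow> (nat \<Rightarrow> grid_fun) \<Rightarrow> nat \<Rightarrow> bool" where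
  "crank_nicolson_step \<delta> \<alpha> v_c R h k V n \<longleftrightarrow>
     (let r = R ((real n + 1/2) * k); U = midpoint_level V n in
      \<forall>i. 1 / k * (V (Suc n) i - V n i) + lin_op \<delta> \<alpha> h r U i
          = v_c / (6 * h * r\<^sup>2) * phi U U i)"

end

theory Submission
  imports Defs "HOL-Homology.Homology"
begin

text \<open>
  One time step amounts to finding a zero of
  \<open>G U = 2 / k * (U - W) + L U - c * \<phi> U U\<close> on the space of periodic grid functions, where \<open>U\<close> is
  the unknown midpoint value. Since \<open>\<langle>\<phi> U U, U\<rangle> = 0\<close> by telescoping, and since completing the square
  yields \<open>\<langle>L U, U\<rangle> \<ge> - (\<alpha> - 1 - \<delta> / r\<^sup>2)\<^sup>2 / (4 * \<delta>) * \<langle>U, U\<rangle>\<close>, the bound on \<open>k\<close> makes \<open>\<langle>G U, U\<rangle>\<close>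
  positive on a large sphere, so that \<open>G\<close> has a zero inside by Brouwer's theorem. The radius increases
  and starts above \<open>sqrt (\<delta> / (\<alpha> - 1))\<close>, so the bound at time \<open>T\<close> implies the one needed at
  every earlier time.
\<close>

section \<open>Zeros of vector fields pointing outwards on a sphere\<close>

text \<open>The dimension will be the number of grid points, a variable. Vectors are therefore
  functions on the naturals that vanish from index \<open>n\<close> on, which for positive
  \<open>n\<close> makes this the carrier of \<open>nsphere (n - 1)\<close>.\<close>

definition sphere_nat :: "nat \<Rightarrow> (nat \<Rightarrow> real) set" where
  "sphere_nat n = {x. (\<Sum>i<n. (x i)\<^sup>2) = 1 \<and> (\<forall>i\<ge>n. x i = 0)}"

lemma not_contractible_sphere_nat:
  assumes "n \<ge> 1"
  shows "\<not> contractible (sphere_nat n)"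
proof -
  obtain p where p: "n = Suc p"
    using assms by (metis One_nat_def Suc_le_D)
  have "nsphere p = top_of_set (sphere_nat n)"
    by (simp add: nsphere euclidean_product_topology sphere_nat_def p lessThan_Suc_atMost Suc_le_eq)
  then show ?thesis
    using non_contractible_space_nsphere[of p] by simp
qed

text \<open>Cutting off the coordinates from \<open>n\<close> on leaves \<open>v\<close>
  unconstrained there: the result is on the sphere as soon as some earlier coordinate is
  nonzero.\<close>

definition normalize_nat :: "nat \<Rightarrow> (nat \<Rightarrow> real) \<Rightarrow> nat \<Rightarrow> real" where
  "normalize_nat n v = (\<lambda>i. if i < n then v i / sqrt (\<Sum>j<n. (v j)\<^sup>2) else 0)"

lemma normalize_nat_in_sphere:
  assumes "i < n" and "v i \<noteq> 0"
  shows "normalize_nat n v \<in> sphere_nat n"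
proof -
  have "(\<Sum>j<n. (v j)\<^sup>2) > 0"
    using assms by (intro sum_pos2[of _ i]) auto
  then show ?thesis
    by (simp add: sphere_nat_def normalize_nat_def power_divide flip: sum_divide_distrib)
qed

lemma normalize_nat_id: "x \<in> sphere_nat n \<Longrightarrow> normalize_nat n x = x"
  by (auto simp: sphere_nat_def normalize_nat_def fun_eq_iff)

text \<open>A homotopy without zeros among the first \<open>n\<close> coordinates stays continuous
  when divided by its norm, so it induces a homotopy into the sphere.\<close>

lemma homotopic_normalize_nat:
  assumes cont: "\<And>i. i < n \<Longrightarrow> continuous_on ({0..1} \<times> S) (\<lambda>z. F (fst z) (snd z) i)"
    and nz: "\<And>t x. t \<in> {0..1} \<Longrightarrow> x \<in> S \<Longrightarrow> \<exists>i<n. F t x i \<noteq> 0"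
  shows "homotopic_with_canon (\<lambda>_. True) S (sphere_nat n)
           (\<lambda>x. normalize_nat n (F 0 x)) (\<lambda>x. normalize_nat n (F (1::real) x))"
proof -
  have pos: "sqrt (\<Sum>j<n. (F (fst z) (snd z) j)\<^sup>2) \<noteq> 0" if z: "z \<in> {0..1} \<times> S" for z
  proof -
    obtain i where "i < n" "F (fst z) (snd z) i \<noteq> 0"
      using nz[of "fst z" "snd z"] z by auto
    then have "(\<Sum>j<n. (F (fst z) (snd z) j)\<^sup>2) > 0"
      by (intro sum_pos2[of _ i]) auto
    then show ?thesis
      by simp
  qed
  have "continuous_on ({0..1} \<times> S) (\<lambda>z. normalize_nat n (F (fst z) (snd z)))"
  proof (rule continuous_on_coordinatewise_then_product)
    fix i
    have "continuous_on ({0..1} \<times> S)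
            (\<lambda>z. F (fst z) (snd z) i / sqrt (\<Sum>j<n. (F (fst z) (snd z) j)\<^sup>2))" if "i < n"
      using that pos by (intro continuous_intros cont) auto
    then show "continuous_on ({0..1} \<times> S) (\<lambda>z. normalize_nat n (F (fst z) (snd z)) i)"
      by (cases "i < n") (simp_all add: normalize_nat_def)
  qed
  moreover have "normalize_nat n (F t x) \<in> sphere_nat n" if tx: "t \<in> {0..1}" "x \<in> S" for t x
    using nz[OF tx] normalize_nat_in_sphere by blast
  ultimately show ?thesis
    unfolding homotopic_with_def
    by (intro exI[of _ "\<lambda>z. normalize_nat n (F (fst z) (snd z))"]) auto
qed

text \<open>Otherwise the sphere would contract along \<open>G x / |G x|\<close>, first from the identity to the
  restriction of \<open>G\<close> to the sphere of radius \<open>\<rho>\<close>, then radially.\<close>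

lemma zero_of_outward_field:
  fixes G :: "(nat \<Rightarrow> real) \<Rightarrow> nat \<Rightarrow> real"
  assumes n: "n \<ge> 1" and \<rho>: "\<rho> > 0"
    and cont: "\<And>i. i < n \<Longrightarrow> continuous_on UNIV (\<lambda>x. G x i)"
    and outward: "\<And>x. (\<Sum>i<n. (x i)\<^sup>2) = \<rho>\<^sup>2 \<Longrightarrow> (\<Sum>i<n. G x i * x i) > 0"
  shows "\<exists>x. \<forall>i<n. G x i = 0"
proof (rule ccontr)
  assume "\<not> ?thesis"
  then have nz: "\<exists>i<n. G x i \<noteq> 0" for x
    by auto
  let ?S = "sphere_nat n"
  \<comment> \<open>\<open>F\<close> is the segment from \<open>x\<close> to \<open>G\<close> at
    \<open>\<rho> * x\<close>; its inner product with \<open>x\<close> is a convex combination of 1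
    and a positive number, so it never vanishes. \<open>F'\<close> shrinks the argument to the
    origin, ending in a constant map; it is nonzero because \<open>G\<close> is assumed to have no
    zero.\<close>
  define F where "F = (\<lambda>t x i. (1 - t) * x i + t * G (\<lambda>j. \<rho> * x j) i)"
  define F' where "F' = (\<lambda>t x. G (\<lambda>j. (1 - t) * (\<rho> * x j)))"
  have coord: "continuous_on A (\<lambda>z. snd z j)" for A :: "(real \<times> (nat \<Rightarrow> real)) set" and j
    by (intro continuous_on_product_then_coordinatewise[where f = snd] continuous_on_snd continuous_on_id)
  have comp: "continuous_on A (\<lambda>z. G (g z) i)"
    if "i < n" "\<And>j. continuous_on A (\<lambda>z. g z j)"
    for A :: "(real \<times> (nat \<Rightarrow> real)) set" and g i
    by (rule continuous_on_compose2[OF cont[OF that(1)]])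
       (use that(2) in \<open>auto intro: continuous_on_coordinatewise_then_product\<close>)
  have "homotopic_with_canon (\<lambda>_. True) ?S ?S (\<lambda>x. normalize_nat n (F 0 x)) (\<lambda>x. normalize_nat n (F 1 x))"
  proof (rule homotopic_normalize_nat)
    show "continuous_on ({0..1} \<times> ?S) (\<lambda>z. F (fst z) (snd z) i)" if "i < n" for i
      unfolding F_def by (intro continuous_intros comp coord that)
    show "\<exists>i<n. F t x i \<noteq> 0" if t: "t \<in> {0..1}" and x: "x \<in> ?S" for t x
    proof (rule ccontr)
      assume "\<not> ?thesis"
      then have "(\<Sum>i<n. F t x i * x i) = 0"
        by simp
      moreover have "(\<Sum>i<n. F t x i * x i)
          = (1 - t) * (\<Sum>i<n. (x i)\<^sup>2) + t * (\<Sum>i<n. G (\<lambda>j. \<rho> * x j) i * x i)"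
        by (simp add: F_def sum_distrib_left power2_eq_square algebra_simps flip: sum.distrib)
      moreover have x1: "(\<Sum>i<n. (x i)\<^sup>2) = 1"
        using x by (simp add: sphere_nat_def)
      moreover have "(\<Sum>i<n. G (\<lambda>j. \<rho> * x j) i * x i) > 0"
      proof -
        have "0 < (\<Sum>i<n. G (\<lambda>j. \<rho> * x j) i * (\<rho> * x i))"
          by (rule outward) (simp add: power_mult_distrib x1 flip: sum_distrib_left)
        also have "\<dots> = \<rho> * (\<Sum>i<n. G (\<lambda>j. \<rho> * x j) i * x i)"
          by (simp add: sum_distrib_left algebra_simps)
        finally show ?thesis
          using \<rho> by (simp add: zero_less_mult_iff)
      qed
      ultimately show False
        using t by (smt (verit) atLeastAtMost_iff mult_cancel_left2 mult_pos_pos mult_zero_left)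
    qed
  qed
  moreover have "homotopic_with_canon (\<lambda>_. True) ?S ?S
      (\<lambda>x. normalize_nat n (F' 0 x)) (\<lambda>x. normalize_nat n (F' 1 x))"
    by (rule homotopic_normalize_nat) (auto simp: F'_def nz intro!: continuous_intros comp coord)
  moreover have "F 1 = F' 0"
    by (simp add: F_def F'_def fun_eq_iff)
  ultimately have "homotopic_with_canon (\<lambda>_. True) ?S ?S
      (\<lambda>x. normalize_nat n (F 0 x)) (\<lambda>x. normalize_nat n (F' 1 x))"
    using homotopic_with_trans by force
  then have "homotopic_with_canon (\<lambda>_. True) ?S ?S id (\<lambda>x. normalize_nat n (G (\<lambda>_. 0)))"
    by (rule homotopic_with_eq) (auto simp: F_def F'_def normalize_nat_id)
  then show False
    using not_contractible_sphere_nat[OF n] unfolding contractible_def by blast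
qed

section \<open>Summation over a period\<close>

lemma periodic_gridD: "V \<in> periodic_grid J \<Longrightarrow> V (i + int J) = V i"
  by (simp add: periodic_grid_def)

lemma periodic_grid_shift:
  assumes "V \<in> periodic_grid J"
  shows "(\<lambda>i. V (i + a)) \<in> periodic_grid J" "(\<lambda>i. V (i - a)) \<in> periodic_grid J"
  using periodic_gridD[OF assms, of "_ + a"] periodic_gridD[OF assms, of "_ - a"]
  by (simp_all add: periodic_grid_def algebra_simps)

lemma periodic_grid_mod: "(\<lambda>i. f (i mod int J)) \<in> periodic_grid J"
  by (simp add: periodic_grid_def)

lemma periodic_grid_eq_mod:
  assumes "V \<in> periodic_grid J"
  shows "V i = V (i mod int J)"
proof -
  have mult: "V (a + int m * int J) = V a" for a m
    by (induction m) (simp_all add: algebra_simps, metis add.assoc add.commute assms periodic_gridD)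
  show ?thesis
  proof (cases "i div int J \<ge> 0")
    case True
    then show ?thesis
      using mult[of "i mod int J" "nat (i div int J)"] by simp
  next
    \<comment> \<open>\<open>mult\<close> only adds nonnegative multiples of the period, so for a
      negative quotient it is applied at \<open>i\<close>, climbing up to
      \<open>i mod int J\<close>.\<close>
    case False
    then show ?thesis
      using mult[of i "nat (- (i div int J))"] by (simp add: minus_div_mult_eq_mod)
  qed
qed

lemma sum_periodic_shift:
  assumes "V \<in> periodic_grid J"
  shows "(\<Sum>j<J. V (int j + 1)) = (\<Sum>j<J. V (int j))"
proof -
  have "V 0 + (\<Sum>j<J. V (int j + 1)) = (\<Sum>j<Suc J. V (int j))"
    by (subst sum.lessThan_Suc_shift) (simp add: add.commute)
  also have "\<dots> = (\<Sum>j<J. V (int j)) + V 0"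
    using periodic_gridD[OF assms, of 0] by simp
  finally show ?thesis
    by simp
qed

lemma laplace_h_periodic: "V \<in> periodic_grid J \<Longrightarrow> laplace_h h V \<in> periodic_grid J"
  using periodic_grid_shift[of V J 1]
  by (simp add: periodic_grid_def laplace_h_def)

lemma bilaplace_h_eq: "bilaplace_h h V = laplace_h h (laplace_h h V)"
  by (simp add: bilaplace_h_def laplace_h_def)

lemma lin_op_periodic: "V \<in> periodic_grid J \<Longrightarrow> lin_op \<delta> \<alpha> h r V \<in> periodic_grid J"
  using laplace_h_periodic[of V J h] laplace_h_periodic[of "laplace_h h V" J h]
  by (simp add: periodic_grid_def lin_op_def bilaplace_h_eq)

lemma phi_periodic: "V \<in> periodic_grid J \<Longrightarrow> phi V V \<in> periodic_grid J"
  using periodic_grid_shift[of V J 1]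
  by (simp add: periodic_grid_def phi_def)

text \<open>Discrete Green identity: the two summands differ by the forward difference of the
  discrete Wronskian \<open>f\<close>, which sums to zero over a period.\<close>

lemma sum_laplace_h_symmetric:
  assumes V: "V \<in> periodic_grid J" and W: "W \<in> periodic_grid J"
  shows "(\<Sum>j<J. laplace_h h V (int j) * W (int j)) = (\<Sum>j<J. V (int j) * laplace_h h W (int j))"
proof -
  define f where "f i = (V i * W (i - 1) - V (i - 1) * W i) / h\<^sup>2" for i
  have "f \<in> periodic_grid J"
    using V W periodic_grid_shift[OF V, of 1] periodic_grid_shift[OF W, of 1]
    by (simp add: periodic_grid_def f_def)
  moreover have "laplace_h h V i * W i - V i * laplace_h h W i = f (i + 1) - f i" for i
    by (simp add: laplace_h_def f_def algebra_simps flip: diff_divide_distrib add_divide_distrib)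
  ultimately have "(\<Sum>j<J. laplace_h h V (int j) * W (int j) - V (int j) * laplace_h h W (int j)) = 0"
    by (simp add: sum_subtractf sum_periodic_shift)
  then show ?thesis
    by (simp add: sum_subtractf)
qed

lemma sum_phi_self:
  assumes V: "V \<in> periodic_grid J"
  shows "(\<Sum>j<J. phi V V (int j) * V (int j)) = 0"
proof -
  \<comment> \<open>The summand expands to \<open>V i * ((V (i + 1))\<^sup>2 - (V (i - 1))\<^sup>2)
    + (V i)\<^sup>2 * (V (i + 1) - V (i - 1))\<close>. Grouping by neighbour gives the difference of
    this flux across the two adjacent edges.\<close>
  define f where "f i = V (i - 1) * V i * (V (i - 1) + V i)" for i
  have "f \<in> periodic_grid J"
    using V periodic_grid_shift[OF V, of 1] by (simp add: periodic_grid_def f_def)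
  moreover have "phi V V i * V i = f (i + 1) - f i" for i
    by (simp add: phi_def f_def algebra_simps)
  ultimately show ?thesis
    by (simp add: sum_subtractf sum_periodic_shift)
qed

section \<open>Solvability of the scheme\<close>

text \<open>Symmetry of the discrete Laplacian turns the fourth-order term into a sum of squares of
  \<open>L\<close>. What remains is a quadratic form in \<open>L\<close> and \<open>V\<close> at
  each grid point, so the estimate is pointwise.\<close>

lemma lin_op_lower_bound:
  assumes V: "V \<in> periodic_grid J" and \<delta>: "\<delta> > 0" and r: "r > 0"
  shows "(\<Sum>j<J. lin_op \<delta> \<alpha> h r V (int j) * V (int j))
           \<ge> - (\<alpha> - 1 - \<delta> / r\<^sup>2)\<^sup>2 / (4 * \<delta>) * (\<Sum>j<J. (V (int j))\<^sup>2)"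
proof -
  define A D where "A = \<alpha> - 1" and "D = \<delta> / r\<^sup>2"
  define L where "L = laplace_h h V"
  have bi: "(\<Sum>j<J. bilaplace_h h V (int j) * V (int j)) = (\<Sum>j<J. L (int j) * L (int j))"
    unfolding bilaplace_h_eq L_def by (rule sum_laplace_h_symmetric[OF laplace_h_periodic[OF V] V])
  have "(\<Sum>j<J. lin_op \<delta> \<alpha> h r V (int j) * V (int j))
      = \<delta> / r ^ 4 * (\<Sum>j<J. bilaplace_h h V (int j) * V (int j))
        + (\<Sum>j<J. 1 / r\<^sup>2 * (A + D) * L (int j) * V (int j) + A / r\<^sup>2 * (V (int j))\<^sup>2)"
    by (simp add: lin_op_def A_def D_def L_def sum_distrib_left power2_eq_square ring_distribs
        mult.assoc add.assoc add_divide_distrib diff_divide_distrib flip: sum.distrib)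
  also have "\<dots> = (\<Sum>j<J. \<delta> / r ^ 4 * (L (int j))\<^sup>2 + (1 / r\<^sup>2 * (A + D) * L (int j) * V (int j)
        + A / r\<^sup>2 * (V (int j))\<^sup>2))"
    unfolding bi by (simp add: sum_distrib_left sum.distrib power2_eq_square)
  also have "\<dots> \<ge> (\<Sum>j<J. - (A - D)\<^sup>2 / (4 * \<delta>) * (V (int j))\<^sup>2)"
  proof (rule sum_mono)
    fix j
    define x u where "x = L (int j)" and "u = V (int j)"
    \<comment> \<open>Since \<open>A / r\<^sup>2 = A * D / \<delta>\<close>, completing the square
      leaves the coefficient \<open>(4 * A * D - (A + D)\<^sup>2) / (4 * \<delta>)\<close> of
      \<open>u\<^sup>2\<close>.\<close>
    have "\<delta> / r ^ 4 * x\<^sup>2 + (1 / r\<^sup>2 * (A + D) * x * u + A / r\<^sup>2 * u\<^sup>2)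
        = \<delta> * (x / r\<^sup>2 + (A + D) * u / (2 * \<delta>))\<^sup>2 - (A - D)\<^sup>2 / (4 * \<delta>) * u\<^sup>2"
      using \<delta> r unfolding D_def
      by (simp add: field_simps power2_eq_square power4_eq_xxxx)
    also have "\<dots> \<ge> - (A - D)\<^sup>2 / (4 * \<delta>) * u\<^sup>2"
      using \<delta> by simp
    finally show "- (A - D)\<^sup>2 / (4 * \<delta>) * (V (int j))\<^sup>2
        \<le> \<delta> / r ^ 4 * (L (int j))\<^sup>2 + (1 / r\<^sup>2 * (A + D) * L (int j) * V (int j) + A / r\<^sup>2 * (V (int j))\<^sup>2)"
      by (simp add: x_def u_def)
  qed
  finally show ?thesis
    by (simp add: A_def D_def sum_distrib_left)
qed

text \<open>With \<open>U\<close> the mean of the old level \<open>W\<close> and the new one, the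
  difference quotient in time is \<open>2 / k * (U - W)\<close>. The factor \<open>c\<close> is
  arbitrary because the nonlinear term drops out of the energy.\<close>

lemma midpoint_exists:
  assumes J: "J \<ge> 1" and W: "W \<in> periodic_grid J"
    and \<delta>: "\<delta> > 0" and r: "r > 0" and k: "k > 0"
    and small: "k * (\<alpha> - 1 - \<delta> / r\<^sup>2)\<^sup>2 < 8 * \<delta>"
  shows "\<exists>U \<in> periodic_grid J. \<forall>i. 2 / k * (U i - W i) + lin_op \<delta> \<alpha> h r U i = c * phi U U i"
proof -
  define U where "U x i = x (nat (i mod int J))" for x :: "nat \<Rightarrow> real" and i
  define G where "G x j = 2 / k * (U x (int j) - W (int j)) + lin_op \<delta> \<alpha> h r (U x) (int j)
    - c * phi (U x) (U x) (int j)" for x j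
  \<comment> \<open>The coercivity constant left after the lower bound for the linear operator;
    \<open>small\<close> says exactly that it is positive.\<close>
  define \<mu> where "\<mu> = 2 / k - (\<alpha> - 1 - \<delta> / r\<^sup>2)\<^sup>2 / (4 * \<delta>)"
  have \<mu>: "\<mu> > 0"
    using small k \<delta> by (simp add: \<mu>_def field_simps)
  \<comment> \<open>Young's inequality with weight \<open>\<mu>\<close> bounds the term in
    \<open>W\<close> by \<open>C\<close> plus half of the coercive term. The radius
    \<open>\<rho>\<close> makes the other half equal to \<open>C + 1\<close>, so the pairing is at
    least 1 on the sphere.\<close>
  define C where "C = (\<Sum>j<J. (2 / k)\<^sup>2 / (2 * \<mu>) * (W (int j))\<^sup>2)"
  have C: "C \<ge> 0"
    unfolding C_def using \<mu> by (intro sum_nonneg) simp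
  define \<rho> where "\<rho> = sqrt (2 * (C + 1) / \<mu>)"
  have U: "U x \<in> periodic_grid J" for x
    unfolding U_def by (rule periodic_grid_mod)
  have U_int: "U x (int j) = x j" if "j < J" for x j
    using that by (simp add: U_def flip: of_nat_mod)
  have contU: "continuous_on UNIV (\<lambda>x. U x i)" for i
    by (simp add: U_def)
  have "\<exists>x. \<forall>j<J. G x j = 0"
  proof (rule zero_of_outward_field[OF J])
    show "\<rho> > 0"
      using C \<mu> by (simp add: \<rho>_def)
    show "continuous_on UNIV (\<lambda>x. G x j)" for j
      unfolding G_def lin_op_def bilaplace_h_def laplace_h_def phi_def divide_inverse
      by (intro continuous_intros contU)
    fix x :: "nat \<Rightarrow> real"
    assume x: "(\<Sum>j<J. (x j)\<^sup>2) = \<rho>\<^sup>2"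
    have Ux: "(\<Sum>j<J. (U x (int j))\<^sup>2) = \<rho>\<^sup>2"
      using x by (simp add: U_int)
    have "(\<Sum>j<J. G x j * x j) = (\<Sum>j<J. G x j * U x (int j))"
      by (simp add: U_int)
    also have "\<dots> = (\<Sum>j<J. 2 / k * (U x (int j))\<^sup>2 - 2 / k * W (int j) * U x (int j))
        + (\<Sum>j<J. lin_op \<delta> \<alpha> h r (U x) (int j) * U x (int j))
        - c * (\<Sum>j<J. phi (U x) (U x) (int j) * U x (int j))"
      by (simp add: G_def sum_distrib_left power2_eq_square algebra_simps
          flip: sum.distrib sum_subtractf)
    also have "\<dots> = 2 / k * \<rho>\<^sup>2 - (\<Sum>j<J. 2 / k * W (int j) * U x (int j))
        + (\<Sum>j<J. lin_op \<delta> \<alpha> h r (U x) (int j) * U x (int j))"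
      unfolding sum_subtractf sum_phi_self[OF U]
      by (simp only: Ux mult_zero_right diff_zero flip: sum_distrib_left)
    also have "\<dots> \<ge> \<mu> * \<rho>\<^sup>2 - (\<Sum>j<J. 2 / k * W (int j) * U x (int j))"
      using lin_op_lower_bound[OF U \<delta> r, of \<alpha> x h] by (simp add: Ux \<mu>_def left_diff_distrib)
    finally have lower: "(\<Sum>j<J. G x j * x j) \<ge> \<mu> * \<rho>\<^sup>2 - (\<Sum>j<J. 2 / k * W (int j) * U x (int j))" .
    have "(\<Sum>j<J. 2 / k * W (int j) * U x (int j))
        \<le> (\<Sum>j<J. (2 / k)\<^sup>2 / (2 * \<mu>) * (W (int j))\<^sup>2 + \<mu> / 2 * (U x (int j))\<^sup>2)"
    proof (rule sum_mono)
      fix j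
      define a b where "a = 2 / k * W (int j)" and "b = U x (int j)"
      have "a\<^sup>2 / (2 * \<mu>) + \<mu> / 2 * b\<^sup>2 - a * b = (a - \<mu> * b)\<^sup>2 / (2 * \<mu>)"
        using \<mu> by (simp add: field_simps power2_eq_square)
      also have "\<dots> \<ge> 0"
        using \<mu> by simp
      finally show "2 / k * W (int j) * U x (int j)
          \<le> (2 / k)\<^sup>2 / (2 * \<mu>) * (W (int j))\<^sup>2 + \<mu> / 2 * (U x (int j))\<^sup>2"
        by (simp add: a_def b_def power_mult_distrib power_divide)
    qed
    also have "\<dots> = C + \<mu> / 2 * \<rho>\<^sup>2"
      by (simp only: C_def sum.distrib Ux flip: sum_distrib_left)
    finally have "(\<Sum>j<J. G x j * x j) \<ge> \<mu> / 2 * \<rho>\<^sup>2 - C"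
      using lower by simp
    moreover have "\<mu> / 2 * \<rho>\<^sup>2 = C + 1"
      using C \<mu> by (simp add: \<rho>_def)
    ultimately show "(\<Sum>j<J. G x j * x j) > 0"
      by linarith
  qed
  then obtain x where x: "\<And>j. j < J \<Longrightarrow> G x j = 0"
    by blast
  \<comment> \<open>The zero of \<open>G\<close> gives the equation only at the indices 0 to
    \<open>J - 1\<close>; periodicity of the residual carries it to all integers.\<close>
  define E where "E i = 2 / k * (U x i - W i) + lin_op \<delta> \<alpha> h r (U x) i - c * phi (U x) (U x) i" for i
  have "E \<in> periodic_grid J"
    using U[of x] W lin_op_periodic[OF U[of x], of \<delta> \<alpha> h r] phi_periodic[OF U[of x]]
    by (simp add: periodic_grid_def E_def)
  then have "E i = E (int (nat (i mod int J)))" for i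
    using J periodic_grid_eq_mod[of E J i] by simp
  moreover have "E (int (nat (i mod int J))) = 0" for i
    using x[of "nat (i mod int J)"] J by (simp add: E_def G_def nat_less_iff)
  ultimately show ?thesis
    using U[of x] by (intro bexI[of _ "U x"]) (simp_all add: E_def)
qed

section \<open>Monotonicity of the radius and recursion over the time levels\<close>

lemma nondecreasing_of_deriv_within:
  fixes R R' :: "real \<Rightarrow> real"
  assumes "\<And>t. t \<in> {a..b} \<Longrightarrow> (R has_real_derivative R' t) (at t within {a..b})"
    and "\<And>t. t \<in> {a..b} \<Longrightarrow> R' t \<ge> 0"
    and "a \<le> s" "s \<le> t" "t \<le> b"
  shows "R s \<le> R t"
proof (rule DERIV_nonneg_imp_increasing_open[OF \<open>s \<le> t\<close>])
  have "continuous_on {a..b} R"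
    by (rule DERIV_continuous_on) (rule assms(1))
  then show "continuous_on {s..t} R"
    by (rule continuous_on_subset) (use assms in auto)
  \<comment> \<open>At interior points the derivative within the interval is two-sided; the
    endpoints are covered by continuity.\<close>
  fix x assume x: "s < x" "x < t"
  then have "(R has_real_derivative R' x) (at x)"
    using assms(1)[of x] assms(3-5) by (simp add: at_within_Icc_at)
  then show "\<exists>y. (R has_real_derivative y) (at x) \<and> y \<ge> 0"
    using assms(2)[of x] assms(3-5) x by auto
qed

theorem proposition2:
  fixes \<delta> \<alpha> v_c T h k :: real
    and R R' v0 :: "real \<Rightarrow> real"
    and J N :: nat
  assumes "\<delta> > 0" and "\<alpha> > 0" and "T > 0"
    and "J \<ge> 1" and "N \<ge> 1"
    and "h = 2 * pi / real J" and "k = T / real N"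
    and R_pos: "\<And>t. t \<in> {0..T} \<Longrightarrow> R t > 0"
    and R_deriv: "\<And>t. t \<in> {0..T} \<Longrightarrow> (R has_real_derivative R' t) (at t within {0..T})"
    and R_ode: "\<And>t. t \<in> {0..T} \<Longrightarrow> R' t = v_c + (\<alpha> - 1) / R t"
    and R_expanding: "\<And>t. t \<in> {0..T} \<Longrightarrow> R' t > 0"
    and v0_periodic: "\<And>x. v0 (x + 2 * pi) = v0 x"
    and v0_mean: "h * (\<Sum>i=1..J. v0 (real i * h)) = 0"
    and "\<alpha> > 1"
    and "R 0 > sqrt (\<delta> / (\<alpha> - 1))"
    and "k < 8 * \<delta> / (\<alpha> - 1 - \<delta> / (R T)\<^sup>2)\<^sup>2"
  shows "\<exists>V :: nat \<Rightarrow> grid_fun.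
           V 0 = (\<lambda>i. v0 (of_int i * h))
         \<and> (\<forall>n\<in>{1..N}. V n \<in> periodic_grid J)
         \<and> (\<forall>n<N. crank_nicolson_step \<delta> \<alpha> v_c R h k V n)"
proof -
  have k: "k > 0"
    using assms by simp
  have mono: "R s \<le> R t" if "0 \<le> s" "s \<le> t" "t \<le> T" for s t
    by (rule nondecreasing_of_deriv_within[OF R_deriv _ that]) (simp_all add: R_expanding less_imp_le)
  have "\<delta> / (\<alpha> - 1) < (R 0)\<^sup>2"
    using \<open>R 0 > sqrt (\<delta> / (\<alpha> - 1))\<close> R_pos[of 0] \<open>T > 0\<close>
    by (metis abs_of_pos atLeastAtMost_iff less_imp_le order_refl real_sqrt_abs real_sqrt_less_iff)
  then have R0: "\<delta> < (\<alpha> - 1) * (R 0)\<^sup>2"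
    using \<open>\<alpha> > 1\<close> by (simp add: field_simps)
  \<comment> \<open>Together these place \<open>\<alpha> - 1 - \<delta> / (R t)\<^sup>2\<close>
    between 0 and its value at \<open>T\<close>; the sign is needed to compare the squares.\<close>
  have ratio: "\<delta> / (R t)\<^sup>2 < \<alpha> - 1" "\<delta> / (R T)\<^sup>2 \<le> \<delta> / (R t)\<^sup>2" if t: "t \<in> {0..T}" for t
  proof -
    have "(R 0)\<^sup>2 \<le> (R t)\<^sup>2"
      using t \<open>T > 0\<close> R_pos[of 0] mono[of 0 t] by (intro power_mono) auto
    then have "\<delta> < (\<alpha> - 1) * (R t)\<^sup>2"
      using R0 \<open>\<alpha> > 1\<close> by (smt (verit) mult_left_mono)
    then show "\<delta> / (R t)\<^sup>2 < \<alpha> - 1"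
      using R_pos[OF t] by (simp add: field_simps)
    show "\<delta> / (R T)\<^sup>2 \<le> \<delta> / (R t)\<^sup>2"
      using t R_pos[OF t] mono[of t T] \<open>\<delta> > 0\<close> by (intro divide_left_mono power_mono) auto
  qed
  have small: "k * (\<alpha> - 1 - \<delta> / (R t)\<^sup>2)\<^sup>2 < 8 * \<delta>" if t: "t \<in> {0..T}" for t
  proof -
    have "k * (\<alpha> - 1 - \<delta> / (R t)\<^sup>2)\<^sup>2 \<le> k * (\<alpha> - 1 - \<delta> / (R T)\<^sup>2)\<^sup>2"
      using ratio[OF t] k by (intro mult_left_mono power_mono) auto
    also have "\<dots> < 8 * \<delta>"
      using ratio(1)[of T] \<open>T > 0\<close> \<open>k < _\<close> by (simp add: pos_less_divide_eq)
    finally show ?thesis .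
  qed
  \<comment> \<open>\<open>crank_nicolson_step\<close> takes a whole sequence but reads only the
    levels \<open>n\<close> and \<open>Suc n\<close>, hence the quantifier over \<open>V\<close>.
    Dependent choice needs a successor for every \<open>n\<close>; from \<open>N\<close> on,
    \<open>W\<close> itself serves.\<close>
  have step: "\<exists>V'. V' \<in> periodic_grid J
      \<and> (n < N \<longrightarrow> (\<forall>V. V n = W \<and> V (Suc n) = V' \<longrightarrow> crank_nicolson_step \<delta> \<alpha> v_c R h k V n))"
    if W: "W \<in> periodic_grid J" for n W
  proof (cases "n < N")
    case False
    then show ?thesis
      using W by blast
  next
    case True
    define r where "r = R ((real n + 1/2) * k)"
    have "(real n + 1/2) * k \<le> real N * k"
      using True k by (intro mult_right_mono) auto
    moreover have "real N * k = T"
      using \<open>k = T / real N\<close> \<open>N \<ge> 1\<close> by simp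
    ultimately have t: "(real n + 1/2) * k \<in> {0..T}"
      using k by simp
    obtain U where U: "U \<in> periodic_grid J"
      and eq: "\<And>i. 2 / k * (U i - W i) + lin_op \<delta> \<alpha> h r U i = v_c / (6 * h * r\<^sup>2) * phi U U i"
      using midpoint_exists[OF \<open>J \<ge> 1\<close> W \<open>\<delta> > 0\<close> R_pos[OF t] k small[OF t]] unfolding r_def by blast
    show ?thesis
    proof (intro exI conjI impI allI)
      \<comment> \<open>The new level is recovered by solving \<open>U = (W + V') / 2\<close> for
        \<open>V'\<close>.\<close>
      show "(\<lambda>i. 2 * U i - W i) \<in> periodic_grid J"
        using U W by (simp add: periodic_grid_def)
      fix V :: "nat \<Rightarrow> grid_fun"
      assume V: "V n = W \<and> V (Suc n) = (\<lambda>i. 2 * U i - W i)"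
      then have "midpoint_level V n = U"
        by (simp add: midpoint_level_def)
      moreover have "1 / k * (2 * U i - W i - W i) = 2 / k * (U i - W i)" for i
        by (simp add: algebra_simps diff_divide_distrib)
      ultimately show "crank_nicolson_step \<delta> \<alpha> v_c R h k V n"
        using eq V by (simp add: crank_nicolson_step_def Let_def flip: r_def)
    qed
  qed
  define V0 where "V0 = (\<lambda>i::int. v0 (of_int i * h))"
  have "V0 \<in> periodic_grid J"
  proof -
    have "of_int (i + int J) * h = of_int i * h + 2 * pi" for i
      using \<open>h = _\<close> \<open>J \<ge> 1\<close> by (simp add: field_simps)
    then show ?thesis
      by (simp add: V0_def periodic_grid_def v0_periodic)
  qed
  then have "\<exists>V. \<forall>n. (V n \<in> periodic_grid J \<and> (n = 0 \<longrightarrow> V n = V0))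
      \<and> (n < N \<longrightarrow> (\<forall>V'. V' n = V n \<and> V' (Suc n) = V (Suc n) \<longrightarrow> crank_nicolson_step \<delta> \<alpha> v_c R h k V' n))"
    by (intro dependent_nat_choice) (use step in auto)
  then show ?thesis
    unfolding V0_def by blast
qed

end
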